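(* Let $G=G^{\mathrm{LD}}$ be the symmetry group of the LD relaxation of the integer linear description $A x=b$, $Bx\le d$, $x\in\mathbb{Z}^n$, and suppose the feasible set of the integer linear description is non-empty, with convex hull $P_I$. Let $$\mathrm{Row}_{\mathbb{Q}}(A)^\perp=m_1W_1\oplus\cdots\oplus m_\ell W_\ell$$ be an orthogonal decomposition into irreducible $\mathbb{Q}$-subrepresentations of $G$, where $W_1,\ldots,W_\ell$ are pairwise non-equivalent and $W_j$ occurs with multiplicity $m_j\ge1$. Then $$\dim(P_I)\in\left\{\sum_{j=1}^\ell m_j'\dim_{\mathbb{Q}}(W_j)\ \middle|\ m_j'\in\mathbb{Z},\ 0\le m_j'\le m_j\text{ for }j\in\{1,\ldots,\ell\}\right\}.$$
   Context: An integer linear description (ILD) is a system $Ax=b$, $Bx\le d$, $x\in\mathbb{Z}^n$ with $A\in\mathbb{R}^{m_1\times n}$, $B\in\mathbb{R}^{m_2\times n}$, $b\in\mathbb{R}^{m_1}$, $d\in\mathbb{R}^{m_2}$. Its LD relaxation is the same system with $x\in\mathbb{R}^n$. $P_I$ is the convex hull of all feasible points of the ILD. Standing assumptions: either $P_I$ is bounded or all entries of $A,B,b,d$ are rational; and the LD relaxation is in standard form, i.e. it is feasible, has no redundant constraints, and no inequality of $Bx\le d$ is satisfied with equality by all feasible points of the LD. $G^{\mathrm{LD}}$ is the group of all permutations of the $n$ variables (coordinates) that send feasible points of the LD relaxation to feasible points of the LD relaxation; it acts on $\mathbb{F}^n$ by permutation matrices. $\mathrm{Row}_{\mathbb{Q}}(A)^\perp=\{v\in\mathbb{Q}^n\mid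 Av=0\}$ is the orthogonal complement of the row space, which is $G^{\mathrm{LD}}$-invariant. The dimension of a convex set is the dimension of its affine hull. *)

theory Defs
  imports "HOL-Analysis.Analysis"
begin

section \<open>Integer linear descriptions\<close>

text \<open>
  A description in dimension \<open>CARD('n)\<close>. The matrix \<open>A\<close> of the equations is the family of rows
  \<open>eq_row P 0, \<dots>, eq_row P (num_eq P - 1)\<close> and \<open>b\<close> is \<open>eq_rhs P\<close>; likewise \<open>B\<close> and \<open>d\<close> for the
  inequalities. Rows are indexed by natural numbers rather than by a finite type because a
  finite type is never empty, while there may be no equations or no inequalities. Values at
  indices beyond \<open>num_eq\<close> and \<open>num_ineq\<close> carry no meaning and are never used.
\<close>

record ('n::finite) ild =
  num_eq :: nat
  eq_row :: "nat \<Rightarrow> real ^ 'n"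
  eq_rhs :: "nat \<Rightarrow> real"
  num_ineq :: nat
  ineq_row :: "nat \<Rightarrow> real ^ 'n"
  ineq_rhs :: "nat \<Rightarrow> real"

definition solutions :: "'n::finite ild \<Rightarrow> nat set \<Rightarrow> nat set \<Rightarrow> (real ^ 'n) set" where
  "solutions P I J =
     {x. (\<forall>i\<in>I. eq_row P i \<bullet> x = eq_rhs P i) \<and> (\<forall>j\<in>J. ineq_row P j \<bullet> x \<le> ineq_rhs P j)}"

definition LD_feasible :: "'n::finite ild \<Rightarrow> (real ^ 'n) set" where
  "LD_feasible P = solutions P {..<num_eq P} {..<num_ineq P}"

definition ILD_feasible :: "'n::finite ild \<Rightarrow> (real ^ 'n) set" where
  "ILD_feasible P = {x \<in> LD_feasible P. \<forall>k. x $ k \<in> \<int>}"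

definition integer_hull :: "'n::finite ild \<Rightarrow> (real ^ 'n) set" where
  "integer_hull P = convex hull ILD_feasible P"

definition rational_data :: "'n::finite ild \<Rightarrow> bool" where
  "rational_data P \<longleftrightarrow>
     (\<forall>i<num_eq P. eq_rhs P i \<in> \<rat> \<and> (\<forall>k. eq_row P i $ k \<in> \<rat>)) \<and>
     (\<forall>j<num_ineq P. ineq_rhs P j \<in> \<rat> \<and> (\<forall>k. ineq_row P j $ k \<in> \<rat>))"

text \<open>A constraint is redundant if deleting it does not change the feasible set.\<close>

definition no_redundant_constraints :: "'n::finite ild \<Rightarrow> bool" where
  "no_redundant_constraints P \<longleftrightarrow>
     (\<forall>i<num_eq P. solutions P ({..<num_eq P} - {i}) {..<num_ineq P} \<noteq> LD_feasible P) \<and>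
     (\<forall>j<num_ineq P. solutions P {..<num_eq P} ({..<num_ineq P} - {j}) \<noteq> LD_feasible P)"

definition standard_form :: "'n::finite ild \<Rightarrow> bool" where
  "standard_form P \<longleftrightarrow>
     LD_feasible P \<noteq> {} \<and>
     no_redundant_constraints P \<and>
     (\<forall>j<num_ineq P. \<not> (\<forall>x\<in>LD_feasible P. ineq_row P j \<bullet> x = ineq_rhs P j))"


section \<open>The symmetry group of the LD relaxation\<close>

text \<open>
  \<open>permute_coords \<sigma>\<close> moves the entry at coordinate \<open>k\<close> to coordinate \<open>\<sigma> k\<close>, that is, it sends the
  standard basis vector \<open>e\<^sub>k\<close> to the one at \<open>\<sigma> k\<close>.
\<close>

definition permute_coords :: "('n \<Rightarrow> 'n) \<Rightarrow> 'a ^ 'n \<Rightarrow> 'a ^ ('n::finite)" where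
  "permute_coords \<sigma> v = (\<chi> k. v $ inv \<sigma> k)"

lemma permute_coords_eq_permutation_matrix:
  fixes v :: "'a::semiring_1 ^ 'n::finite"
  assumes "bij \<sigma>"
  shows "permute_coords \<sigma> v = (\<chi> i j. if i = \<sigma> j then 1 else 0) *v v"
proof -
  have "(\<Sum>j\<in>UNIV. (if i = \<sigma> j then 1 else 0) * v $ j) = v $ inv \<sigma> i" for i
  proof -
    have "(i = \<sigma> j) = (j = inv \<sigma> i)" for j
      using assms by (metis bij_inv_eq_iff)
    then show ?thesis by (simp add: if_distrib[of "\<lambda>z. z * _"] cong: if_cong)
  qed
  then show ?thesis by (simp add: permute_coords_def vec_eq_iff matrix_vector_mult_def)
qed

definition LD_group :: "'n::finite ild \<Rightarrow> ('n \<Rightarrow> 'n) set" where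
  "LD_group P = {\<sigma>. bij \<sigma> \<and> (\<forall>x\<in>LD_feasible P. permute_coords \<sigma> x \<in> LD_feasible P)}"


section \<open>Rational representations by coordinate permutations\<close>

text \<open>
  The library locale interpretation \<open>vec\<close> supplies the linear algebra of \<open>rat ^ 'n\<close> over \<open>rat\<close>.
\<close>

definition row_perp :: "'n::finite ild \<Rightarrow> (rat ^ 'n) set" where
  "row_perp P = {v. \<forall>i<num_eq P. eq_row P i \<bullet> (\<chi> k. of_rat (v $ k)) = 0}"

definition subrep :: "('n \<Rightarrow> 'n) set \<Rightarrow> (rat ^ 'n::finite) set \<Rightarrow> bool" where
  "subrep G V \<longleftrightarrow> vec.subspace V \<and> (\<forall>\<sigma>\<in>G. \<forall>v\<in>V. permute_coords \<sigma> v \<in> V)"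

definition irreducible_subrep :: "('n \<Rightarrow> 'n) set \<Rightarrow> (rat ^ 'n::finite) set \<Rightarrow> bool" where
  "irreducible_subrep G V \<longleftrightarrow>
     subrep G V \<and> V \<noteq> {0} \<and> (\<forall>U. subrep G U \<and> U \<subseteq> V \<longrightarrow> U = {0} \<or> U = V)"

definition equivalent_reps ::
  "('n \<Rightarrow> 'n) set \<Rightarrow> (rat ^ 'n::finite) set \<Rightarrow> (rat ^ 'n) set \<Rightarrow> bool" where
  "equivalent_reps G U V \<longleftrightarrow>
     (\<exists>f. bij_betw f U V \<and>
        (\<forall>u\<in>U. \<forall>v\<in>U. f (u + v) = f u + f v) \<and>
        (\<forall>c. \<forall>u\<in>U. f (c *s u) = c *s f u) \<and>
        (\<forall>\<sigma>\<in>G. \<forall>u\<in>U. f (permute_coords \<sigma> u) = permute_coords \<sigma> (f u)))"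

text \<open>
  \<open>V = m\<^sub>1 W\<^sub>1 \<oplus> \<dots> \<oplus> m\<^sub>\<ell> W\<^sub>\<ell>\<close>, an orthogonal decomposition with pairwise non-equivalent irreducible
  \<open>W j\<close>. The indices run over \<open>j < l\<close>; \<open>U j k\<close> for \<open>k < m j\<close> are the \<open>m j\<close> summands of type
  \<open>W j\<close>. Pairwise orthogonality makes the sum of the \<open>U j k\<close> direct.
\<close>

definition orthogonal_irreducible_decomposition ::
  "('n \<Rightarrow> 'n) set \<Rightarrow> (rat ^ 'n::finite) set \<Rightarrow> nat \<Rightarrow> (nat \<Rightarrow> nat) \<Rightarrow>
     (nat \<Rightarrow> (rat ^ 'n) set) \<Rightarrow> bool" where
  "orthogonal_irreducible_decomposition G V l m W \<longleftrightarrow>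
     (\<forall>j<l. irreducible_subrep G (W j) \<and> 1 \<le> m j) \<and>
     (\<forall>i<l. \<forall>j<l. i \<noteq> j \<longrightarrow> \<not> equivalent_reps G (W i) (W j)) \<and>
     (\<exists>U. (\<forall>j<l. \<forall>k<m j. irreducible_subrep G (U j k) \<and> equivalent_reps G (U j k) (W j)) \<and>
        (\<forall>i<l. \<forall>j<l. \<forall>h<m i. \<forall>k<m j. (i, h) \<noteq> (j, k) \<longrightarrow>
           (\<forall>u\<in>U i h. \<forall>v\<in>U j k. scalar_product u v = 0)) \<and>
        vec.span (\<Union>j<l. \<Union>k<m j. U j k) = V)"

end

theory Submission
  imports Defs
begin

text \<open>
  Fix a feasible integer point \<open>a\<close> and let \<open>L\<close> be the rational span of all differences \<open>x - a\<close>
  of feasible integer points. Three observations give the theorem.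

  \<^item> \<open>L\<close> is a subrepresentation of \<open>row_perp P\<close>. All feasible points satisfy the same equations,
    so their differences are orthogonal to the rows. A coordinate permutation
    preserves integrality, so a symmetry of the LD relaxation permutes the feasible integer points
    and hence preserves \<open>L\<close>
    (\<open>permute_integer_differences_in_span\<close>, \<open>integer_differences_subset_row_perp\<close>).

  \<^item> The dimension of the integer hull is \<open>dim\<^sub>\<rat> L\<close>. By translation it is the dimension of the
    real span of the differences, and vectors with rational entries have the same rank over
    \<open>\<rat>\<close> as over \<open>\<real>\<close> (\<open>dim_image_real_vec\<close>).

  \<^item> The dimension of any subrepresentation of an orthogonal sum of irreducibles is the sum of the
    dimensions of some of the summands (\<open>dim_subrep_of_orthogonal_sum\<close>). This is the
    Jordan--Hoelder argument: along the filtration by partial sums, \<open>L\<close> gains at each step either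
    nothing or a whole irreducible summand.

  Counting how many of the chosen summands are equivalent to \<open>W j\<close> gives the multiplicity
  \<open>m' j\<close>.
\<close>

section \<open>Rational vectors over the reals\<close>

definition real_vec :: "rat ^ 'n \<Rightarrow> real ^ 'n" where
  "real_vec v = (\<chi> k. of_rat (v $ k))"

lemma real_vec_nth [simp]: "real_vec v $ k = of_rat (v $ k)"
  by (simp add: real_vec_def)

lemma real_vec_add: "real_vec (u + v) = real_vec u + real_vec v"
  by (simp add: vec_eq_iff of_rat_add)

lemma real_vec_scale: "real_vec (c *s v) = of_rat c *\<^sub>R real_vec v"
  by (simp add: vec_eq_iff of_rat_mult)

lemma real_vec_zero [simp]: "real_vec 0 = 0"
  by (simp add: vec_eq_iff)

lemma inj_real_vec: "inj real_vec"
  by (auto intro!: injI simp: vec_eq_iff)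

lemma real_vec_axis: "real_vec (axis i 1) = axis i 1"
  by (simp add: vec_eq_iff axis_def)

lemma real_vec_permute_coords: "real_vec (permute_coords \<sigma> v) = permute_coords \<sigma> (real_vec v)"
  by (simp add: vec_eq_iff permute_coords_def)

lemma real_vec_span: "real_vec ` vec.span S \<subseteq> span (real_vec ` S)"
proof
  fix y assume "y \<in> real_vec ` vec.span S"
  then obtain v where v: "v \<in> vec.span S" and y: "y = real_vec v" by auto
  have "real_vec v \<in> span (real_vec ` S)"
    using v
  proof (induction rule: vec.span_induct_alt)
    case base
    show ?case by (simp add: span_zero)
  next
    case (step c x w)
    then show ?case
      by (simp add: real_vec_add real_vec_scale span_add span_scale span_base)
  qed
  then show "y \<in> span (real_vec ` S)" by (simp add: y)
qed

text \<open>
  A rationally independent set extends to a basis of \<open>\<rat>\<^sup>n\<close>. The \<open>n\<close> images of the basis vectors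
  still generate all unit vectors, so they span \<open>\<real>\<^sup>n\<close>, and \<open>n\<close> vectors that span are independent.
\<close>

lemma independent_real_vec_image:
  fixes B :: "(rat ^ 'n::finite) set"
  assumes "vec.independent B"
  shows "independent (real_vec ` B)"
proof -
  obtain C where C: "B \<subseteq> C" "vec.independent C" "UNIV \<subseteq> vec.span C"
    using vec.maximal_independent_subset_extend[OF subset_UNIV assms] by metis
  have cardC: "card C = CARD('n)"
    using vec.basis_card_eq_dim[OF subset_UNIV C(3) C(2)] by (simp only: vec_dim_card)
  have finC: "finite C"
    using C(2) by (rule vec.finiteI_independent)
  have "independent (real_vec ` C)"
  proof (rule card_le_dim_spanning)
    have "(Basis :: (real ^ 'n) set) \<subseteq> span (real_vec ` C)"
    proof
      fix b :: "real ^ 'n" assume "b \<in> Basis"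
      then obtain i where "b = axis i 1" by (auto simp: Basis_vec_def)
      then have "b = real_vec (axis i 1)" by (simp add: real_vec_axis)
      then show "b \<in> span (real_vec ` C)"
        using real_vec_span[of C] C(3) by auto
    qed
    then have "span Basis \<subseteq> span (real_vec ` C)"
      by (rule span_minimal) simp
    then show "UNIV \<subseteq> span (real_vec ` C)" by simp
    show "card (real_vec ` C) \<le> dim (UNIV :: (real ^ 'n) set)"
      using card_image_le[OF finC, of real_vec] cardC by simp
  qed (use finC in auto)
  then show ?thesis
    using C(1) independent_mono by blast
qed

lemma dim_image_real_vec:
  fixes D :: "(rat ^ 'n::finite) set"
  shows "dim (real_vec ` D) = vec.dim D"
proof -
  obtain B where B: "B \<subseteq> D" "vec.independent B" "D \<subseteq> vec.span B" "card B = vec.dim D"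
    using vec.basis_exists by blast
  have "card (real_vec ` B) = dim (real_vec ` D)"
  proof (rule basis_card_eq_dim)
    show "real_vec ` D \<subseteq> span (real_vec ` B)"
      using B(3) real_vec_span[of B] by blast
  qed (use B independent_real_vec_image in auto)
  moreover have "card (real_vec ` B) = card B"
    using inj_real_vec by (intro card_image) (auto intro: inj_on_subset)
  ultimately show ?thesis using B(4) by simp
qed


section \<open>Subrepresentations of orthogonal sums\<close>

lemma permute_coords_add: "permute_coords \<sigma> (u + v) = permute_coords \<sigma> u + permute_coords \<sigma> v"
  by (simp add: permute_coords_def vec_eq_iff)

lemma permute_coords_scale: "permute_coords \<sigma> (c *s v) = c *s permute_coords \<sigma> v"
  by (simp add: permute_coords_def vec_eq_iff)

lemma permute_coords_zero: "permute_coords \<sigma> 0 = 0"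
  by (simp add: permute_coords_def vec_eq_iff)

lemma subrep_span:
  assumes "\<And>\<sigma> v. \<sigma> \<in> G \<Longrightarrow> v \<in> S \<Longrightarrow> permute_coords \<sigma> v \<in> vec.span S"
  shows "subrep G (vec.span S)"
  unfolding subrep_def
proof (intro conjI ballI)
  fix \<sigma> v assume \<sigma>: "\<sigma> \<in> G" and v: "v \<in> vec.span S"
  show "permute_coords \<sigma> v \<in> vec.span S"
    using v
  proof (induction rule: vec.span_induct_alt)
    case base
    show ?case by (simp add: permute_coords_zero vec.span_zero)
  next
    case (step c x w)
    then show ?case
      using assms[OF \<sigma>]
      by (simp add: permute_coords_add permute_coords_scale vec.span_add vec.span_scale)
  qed
qed simp

lemma subrep_span_Union:
  assumes "\<And>s. s \<in> S \<Longrightarrow> subrep G (U s)"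
  shows "subrep G (vec.span (\<Union>s\<in>S. U s))"
  using assms by (intro subrep_span) (auto simp: subrep_def intro!: vec.span_base)

lemma subrep_Int: "subrep G U \<Longrightarrow> subrep G V \<Longrightarrow> subrep G (U \<inter> V)"
  by (simp add: subrep_def vec.subspace_inter)

lemma subrep_sums:
  assumes "subrep G U" "subrep G V"
  shows "subrep G {u + v |u v. u \<in> U \<and> v \<in> V}"
  unfolding subrep_def
proof (intro conjI ballI)
  show "vec.subspace {u + v |u v. u \<in> U \<and> v \<in> V}"
    using assms by (intro vec.subspace_sums) (auto simp: subrep_def)
next
  fix \<sigma> w assume "\<sigma> \<in> G" "w \<in> {u + v |u v. u \<in> U \<and> v \<in> V}"
  then show "permute_coords \<sigma> w \<in> {u + v |u v. u \<in> U \<and> v \<in> V}"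
    using assms unfolding subrep_def by clarify (metis permute_coords_add)
qed

lemma scalar_product_span_eq_0:
  fixes u :: "'a::field ^ 'n::finite"
  assumes "v \<in> vec.span S" "\<And>s. s \<in> S \<Longrightarrow> scalar_product u s = 0"
  shows "scalar_product u v = 0"
  using assms(1)
proof (induction rule: vec.span_induct_alt)
  case base
  show ?case by (simp add: scalar_product_def)
next
  case (step c x w)
  have "scalar_product u (c *s x + w) = c * scalar_product u x + scalar_product u w"
    by (simp add: scalar_product_def sum_distrib_left sum.distrib algebra_simps)
  then show ?case using step assms(2) by simp
qed

lemma scalar_product_self_eq_0:
  fixes u :: "'a::linordered_idom ^ 'n::finite"
  assumes "scalar_product u u = 0"
  shows "u = 0"
  using assms by (simp add: scalar_product_def sum_nonneg_eq_0_iff vec_eq_iff)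

text \<open>
  The step of the filtration. The trace of \<open>L + X\<close> on the irreducible \<open>U\<close> is either zero, and then
  \<open>L\<close> lies in \<open>X\<close>, or all of \<open>U\<close>, and then \<open>L + X = U + X\<close>, so that comparing the dimension
  formulas for both sums shows that \<open>L\<close> is larger than \<open>L \<inter> X\<close> by \<open>dim U\<close>.
\<close>

lemma subrep_sum_irreducible_cases:
  fixes L U X :: "(rat ^ 'n::finite) set"
  assumes L: "subrep G L" and X: "subrep G X" and U: "irreducible_subrep G U"
    and LUX: "L \<subseteq> {u + x |u x. u \<in> U \<and> x \<in> X}" and UX: "U \<inter> X = {0}"
  obtains "L \<subseteq> X" | "vec.dim L = vec.dim U + vec.dim (L \<inter> X)"
proof -
  define LX where "LX = {y + x |y x. y \<in> L \<and> x \<in> X}"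
  have subs: "vec.subspace L" "vec.subspace X" "vec.subspace U"
    using L X U by (auto simp: subrep_def irreducible_subrep_def)
  have "subrep G (LX \<inter> U)"
    unfolding LX_def using L X U subrep_sums subrep_Int irreducible_subrep_def by blast
  then consider "LX \<inter> U = {0}" | "LX \<inter> U = U"
    using U unfolding irreducible_subrep_def by (metis inf_le2)
  then show ?thesis
  proof cases
    case 1
    have "y \<in> X" if y: "y \<in> L" for y
    proof -
      obtain u x where ux: "y = u + x" "u \<in> U" "x \<in> X" using LUX y by blast
      then have "u = y + (- x)" by simp
      moreover have "- x \<in> X" using ux(3) subs(2) by (simp add: vec.subspace_neg)
      ultimately have "u \<in> LX \<inter> U" using y ux(2) unfolding LX_def by blast
      then show ?thesis using 1 ux by simp
    qed
    then show ?thesis using that(1) by blast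
  next
    case 2
    have eq: "LX = {u + x |u x. u \<in> U \<and> x \<in> X}"
    proof (intro subset_antisym subsetI)
      fix w assume "w \<in> LX"
      then obtain y x where yx: "w = y + x" "y \<in> L" "x \<in> X" unfolding LX_def by blast
      then obtain u x' where "y = u + x'" "u \<in> U" "x' \<in> X" using LUX by blast
      then have "w = u + (x' + x)" "u \<in> U" "x' + x \<in> X"
        using yx subs(2) by (auto simp: add.assoc vec.subspace_add)
      then show "w \<in> {u + x |u x. u \<in> U \<and> x \<in> X}" by blast
    next
      fix w assume "w \<in> {u + x |u x. u \<in> U \<and> x \<in> X}"
      then obtain u x where ux: "w = u + x" "u \<in> U" "x \<in> X" by blast
      then obtain y x' where "u = y + x'" "y \<in> L" "x' \<in> X" using 2 unfolding LX_def by blast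
      then have "w = y + (x' + x)" "y \<in> L" "x' + x \<in> X"
        using ux subs(2) by (auto simp: add.assoc vec.subspace_add)
      then show "w \<in> LX" unfolding LX_def by blast
    qed
    have "vec.dim LX + vec.dim (L \<inter> X) = vec.dim L + vec.dim X"
      unfolding LX_def using vec.dim_sums_Int subs by blast
    moreover have "vec.dim LX + vec.dim (U \<inter> X) = vec.dim U + vec.dim X"
      unfolding eq using vec.dim_sums_Int subs by blast
    ultimately show ?thesis using UX by (intro that(2)) simp
  qed
qed

theorem dim_subrep_of_orthogonal_sum:
  fixes U :: "'s \<Rightarrow> (rat ^ 'n::finite) set"
  assumes "finite S" and "subrep G L" and "L \<subseteq> vec.span (\<Union>s\<in>S. U s)"
    and "\<And>s. s \<in> S \<Longrightarrow> irreducible_subrep G (U s)"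
    and "\<And>s t u v. \<lbrakk>s \<in> S; t \<in> S; s \<noteq> t; u \<in> U s; v \<in> U t\<rbrakk> \<Longrightarrow> scalar_product u v = 0"
  shows "\<exists>T\<subseteq>S. vec.dim L = (\<Sum>s\<in>T. vec.dim (U s))"
  using assms
proof (induction S arbitrary: L rule: finite_induct)
  case empty
  then have "vec.dim L = 0"
    using vec.dim_subset[of L "{0}"] by auto
  then show ?case by simp
next
  case (insert t S)
  define X where "X = vec.span (\<Union>s\<in>S. U s)"
  have IH: "\<exists>T\<subseteq>S. vec.dim M = (\<Sum>s\<in>T. vec.dim (U s))" if "subrep G M" "M \<subseteq> X" for M
  proof (rule insert.IH)
    show "irreducible_subrep G (U s)" if "s \<in> S" for s
      using that by (simp add: insert.prems(3))
    show "scalar_product u v = 0"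
      if "s \<in> S" "s' \<in> S" "s \<noteq> s'" "u \<in> U s" "v \<in> U s'" for s s' u v
      using that insert.prems(4)[of s s' u v] by simp
  qed (use that in \<open>simp_all add: X_def\<close>)
  have Ut: "irreducible_subrep G (U t)" by (simp add: insert.prems)
  have X: "subrep G X"
    unfolding X_def using insert.prems(3)
    by (intro subrep_span_Union) (simp add: irreducible_subrep_def)
  have "U t \<inter> X = {0}"
  proof -
    have "u = 0" if "u \<in> U t" "u \<in> X" for u
    proof (rule scalar_product_self_eq_0)
      show "scalar_product u u = 0"
      proof (rule scalar_product_span_eq_0[of u "\<Union>s\<in>S. U s"])
        fix v assume "v \<in> (\<Union>s\<in>S. U s)"
        then obtain s where "s \<in> S" "v \<in> U s" by blast
        then show "scalar_product u v = 0"
          using insert.prems(4)[of t s u v] insert.hyps(2) that(1) by auto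
      qed (use that in \<open>simp add: X_def\<close>)
    qed
    moreover have "0 \<in> U t" "0 \<in> X"
      using Ut X by (auto simp: irreducible_subrep_def subrep_def vec.subspace_0)
    ultimately show ?thesis by blast
  qed
  moreover have "L \<subseteq> {u + x |u x. u \<in> U t \<and> x \<in> X}"
  proof -
    have "vec.span (U t) = U t"
      using Ut by (simp only: irreducible_subrep_def subrep_def vec.span_eq_iff)
    then show ?thesis
      using insert.prems(2) vec.span_Un[of "U t"] by (simp only: X_def UN_insert)
  qed
  ultimately consider "L \<subseteq> X" | "vec.dim L = vec.dim (U t) + vec.dim (L \<inter> X)"
    using subrep_sum_irreducible_cases[OF insert.prems(1) X Ut] by metis
  then show ?case
  proof cases
    case 1
    then have "\<exists>T\<subseteq>S. vec.dim L = (\<Sum>s\<in>T. vec.dim (U s))"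
      by (intro IH insert.prems(1))
    then show ?thesis by blast
  next
    case 2
    obtain T where T: "T \<subseteq> S" "vec.dim (L \<inter> X) = (\<Sum>s\<in>T. vec.dim (U s))"
      using IH[OF subrep_Int[OF insert.prems(1) X]] by blast
    have "finite T" "t \<notin> T" using T(1) insert.hyps finite_subset by auto
    then have "vec.dim L = (\<Sum>s\<in>insert t T. vec.dim (U s))" using 2 T(2) by simp
    then show ?thesis using T(1) by blast
  qed
qed

lemma dim_eq_if_equivalent_reps:
  fixes U V :: "(rat ^ 'n::finite) set"
  assumes "vec.subspace U" "equivalent_reps G U V"
  shows "vec.dim U = vec.dim V"
proof -
  obtain f where bij: "bij_betw f U V"
    and add: "\<And>u v. u \<in> U \<Longrightarrow> v \<in> U \<Longrightarrow> f (u + v) = f u + f v"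
    and scale: "\<And>c u. u \<in> U \<Longrightarrow> f (c *s u) = c *s f u"
    using assms(2) unfolding equivalent_reps_def by blast
  obtain B where B: "B \<subseteq> U" "vec.independent B" "U \<subseteq> vec.span B"
    using vec.maximal_independent_subset by blast
  \<comment> \<open>\<open>f\<close> is linear on \<open>U\<close> only; the linear map \<open>g\<close> on the whole space agrees with it there.\<close>
  define g where "g = vec.construct B f"
  have lin: "Vector_Spaces.linear (*s) (*s) g"
    unfolding g_def using B(2) by (rule vec.linear_construct)
  have "u \<in> U \<and> g u = f u" if "u \<in> vec.span B" for u
    using that
  proof (induction rule: vec.span_induct_alt)
    case base
    have "f 0 = 0" using scale[of 0 0] assms(1) vec.subspace_0 by auto
    then show ?case
      using assms(1) vec.linear_0[OF lin] by (simp add: vec.subspace_0)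
  next
    case (step c x w)
    have x: "x \<in> U" "g x = f x"
      using step(1) B vec.construct_basis[OF B(2) step(1)] by (auto simp: g_def)
    have cx: "c *s x \<in> U" using assms(1) x(1) by (simp add: vec.subspace_scale)
    show ?case
      using step x cx assms(1)
      by (simp add: vec.linear_add[OF lin] vec.linear_scale[OF lin] add scale vec.subspace_add)
  qed
  then have gf: "g u = f u" if "u \<in> U" for u using B(3) that by blast
  have "vec.dim (g ` U) = vec.dim U"
  proof (rule vec.dim_image_eq[OF lin])
    have "inj_on g U" using bij inj_on_cong[of U g f, OF gf] by (simp add: bij_betw_def)
    then show "inj_on g (vec.span U)" by (simp only: vec.span_eq_iff[THEN iffD2, OF assms(1)])
  qed
  moreover have "g ` U = V" using bij image_cong[of U U g f, OF refl gf] by (simp add: bij_betw_def)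
  ultimately show ?thesis by simp
qed

text \<open>
  The summands are indexed by pairs \<open>(j, k)\<close> with \<open>k < m j\<close>, so the number of chosen summands
  of type \<open>j\<close> is at most \<open>m j\<close>.
\<close>

lemma dim_subrep_of_orthogonal_irreducible_decomposition:
  assumes dec: "orthogonal_irreducible_decomposition G V l m W"
    and L: "subrep G L" "L \<subseteq> V"
  obtains n :: "nat \<Rightarrow> nat"
  where "\<And>j. j < l \<Longrightarrow> n j \<le> m j" and "vec.dim L = (\<Sum>j<l. n j * vec.dim (W j))"
proof -
  obtain U where
    summands: "\<forall>j<l. \<forall>k<m j. irreducible_subrep G (U j k) \<and> equivalent_reps G (U j k) (W j)"
    and orthogonal: "\<forall>i<l. \<forall>j<l. \<forall>h<m i. \<forall>k<m j. (i, h) \<noteq> (j, k) \<longrightarrow>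
        (\<forall>u\<in>U i h. \<forall>v\<in>U j k. scalar_product u v = 0)"
    and V: "vec.span (\<Union>j<l. \<Union>k<m j. U j k) = V"
    using dec unfolding orthogonal_irreducible_decomposition_def by (elim conjE exE) (rule that)
  have irr: "irreducible_subrep G (U j k)" and equiv: "equivalent_reps G (U j k) (W j)"
    if "j < l" "k < m j" for j k
    using summands that by blast+
  have orth: "scalar_product u v = 0"
    if "i < l" "j < l" "h < m i" "k < m j" "(i, h) \<noteq> (j, k)" "u \<in> U i h" "v \<in> U j k"
    for i j h k u v
    using orthogonal that by blast
  define S where "S = Sigma {..<l} (\<lambda>j. {..<m j})"
  have "L \<subseteq> vec.span (\<Union>s\<in>S. case_prod U s)"
  proof -
    have "(\<Union>s\<in>S. case_prod U s) = (\<Union>j<l. \<Union>k<m j. U j k)" by (auto simp: S_def)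
    then show ?thesis using L(2) V by simp
  qed
  moreover have "finite S" by (simp add: S_def)
  moreover have "irreducible_subrep G (case_prod U s)" if "s \<in> S" for s
    using that irr by (auto simp: S_def)
  moreover have "scalar_product u v = 0"
    if "s \<in> S" "t \<in> S" "s \<noteq> t" "u \<in> case_prod U s" "v \<in> case_prod U t" for s t u v
    using that orth[of "fst s" "fst t" "snd s" "snd t" u v]
    by (auto simp: S_def case_prod_beta prod_eq_iff)
  ultimately obtain T where T: "T \<subseteq> S" "vec.dim L = (\<Sum>s\<in>T. vec.dim (case_prod U s))"
    using dim_subrep_of_orthogonal_sum[OF _ L(1), of S "case_prod U"] by blast
  define n where "n j = card {k. (j, k) \<in> T}" for j
  have sub: "{k. (j, k) \<in> T} \<subseteq> {..<m j}" for j
    using T(1) by (auto simp: S_def)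
  have T_eq: "T = Sigma {..<l} (\<lambda>j. {k. (j, k) \<in> T})"
    using T(1) by (auto simp: S_def)
  have dimU: "vec.dim (U j k) = vec.dim (W j)" if "j < l" "(j, k) \<in> T" for j k
  proof -
    have "k < m j" using that sub by blast
    then show ?thesis
      using that irr[of j k] equiv[of j k]
      by (intro dim_eq_if_equivalent_reps[of _ G]) (simp_all add: irreducible_subrep_def subrep_def)
  qed
  have "vec.dim L = (\<Sum>j<l. \<Sum>k | (j, k) \<in> T. vec.dim (U j k))"
  proof -
    have "vec.dim L = (\<Sum>(j, k)\<in>Sigma {..<l} (\<lambda>j. {k. (j, k) \<in> T}). vec.dim (U j k))"
      unfolding T_eq[symmetric] T(2) by (simp add: case_prod_beta)
    also have "\<dots> = (\<Sum>j<l. \<Sum>k | (j, k) \<in> T. vec.dim (U j k))"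
      using finite_subset[OF sub] by (subst sum.Sigma) auto
    finally show ?thesis .
  qed
  also have "\<dots> = (\<Sum>j<l. n j * vec.dim (W j))"
    by (intro sum.cong refl) (simp add: dimU n_def)
  finally have "vec.dim L = (\<Sum>j<l. n j * vec.dim (W j))" .
  moreover have "n j \<le> m j" for j
    unfolding n_def using card_mono[OF _ sub[of j]] by simp
  ultimately show thesis using that by blast
qed


section \<open>Differences of feasible integer points\<close>

definition integer_differences :: "'n::finite ild \<Rightarrow> real ^ 'n \<Rightarrow> (rat ^ 'n) set" where
  "integer_differences P a = {v. a + real_vec v \<in> ILD_feasible P}"

lemma real_vec_integer_differences:
  assumes "a \<in> ILD_feasible P"
  shows "real_vec ` integer_differences P a = (+) (- a) ` ILD_feasible P"
proof (intro subset_antisym subsetI)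
  fix y assume "y \<in> real_vec ` integer_differences P a"
  then obtain v where "y = - a + (a + real_vec v)" "a + real_vec v \<in> ILD_feasible P"
    by (auto simp: integer_differences_def)
  then show "y \<in> (+) (- a) ` ILD_feasible P" by blast
next
  fix y assume "y \<in> (+) (- a) ` ILD_feasible P"
  then obtain x where x: "x \<in> ILD_feasible P" "y = - a + x" by blast
  define v :: "rat ^ _" where "v = (\<chi> k. of_int \<lfloor>x $ k\<rfloor> - of_int \<lfloor>a $ k\<rfloor>)"
  have "x $ k \<in> \<int>" "a $ k \<in> \<int>" for k
    using x(1) assms by (simp_all add: ILD_feasible_def)
  then have v: "real_vec v = - a + x"
    by (auto simp: vec_eq_iff v_def of_rat_diff of_int_floor)
  then have "v \<in> integer_differences P a"
    using x(1) by (simp add: integer_differences_def)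
  then show "y \<in> real_vec ` integer_differences P a"
    using v x(2) by (metis image_eqI)
qed

lemma permute_coords_ILD_feasible:
  assumes "\<sigma> \<in> LD_group P" "x \<in> ILD_feasible P"
  shows "permute_coords \<sigma> x \<in> ILD_feasible P"
  using assms by (simp add: LD_group_def ILD_feasible_def) (simp add: permute_coords_def)

text \<open>
  A symmetry \<open>\<sigma>\<close> may move the base point, so the image of a difference \<open>x - a\<close> is the
  difference \<open>\<sigma> x - a\<close> minus the difference \<open>\<sigma> a - a\<close>; this is why the span is needed.
\<close>

lemma permute_integer_differences_in_span:
  assumes a: "a \<in> ILD_feasible P" and \<sigma>: "\<sigma> \<in> LD_group P" and v: "v \<in> integer_differences P a"
  shows "permute_coords \<sigma> v \<in> vec.span (integer_differences P a)"
proof -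
  have "- a + permute_coords \<sigma> a \<in> real_vec ` integer_differences P a"
    using permute_coords_ILD_feasible[OF \<sigma> a] by (simp add: real_vec_integer_differences[OF a])
  then obtain w where w: "w \<in> integer_differences P a" "real_vec w = - a + permute_coords \<sigma> a"
    by auto
  have "permute_coords \<sigma> (a + real_vec v) \<in> ILD_feasible P"
    using v \<sigma> permute_coords_ILD_feasible by (auto simp: integer_differences_def)
  then have "w + permute_coords \<sigma> v \<in> integer_differences P a"
    by (simp add: integer_differences_def real_vec_add real_vec_permute_coords w(2)
        permute_coords_add)
  then have "(w + permute_coords \<sigma> v) - w \<in> vec.span (integer_differences P a)"
    using w(1) by (intro vec.span_diff vec.span_base)
  then show ?thesis by simp
qed

lemma subspace_row_perp: "vec.subspace (row_perp P)"
proof -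
  have "row_perp P = {v. \<forall>i<num_eq P. eq_row P i \<bullet> real_vec v = 0}"
    by (simp add: row_perp_def real_vec_def)
  then show ?thesis
    by (simp add: vec.subspace_def real_vec_add real_vec_scale inner_add_right)
qed

lemma integer_differences_subset_row_perp:
  assumes "a \<in> ILD_feasible P"
  shows "integer_differences P a \<subseteq> row_perp P"
proof
  fix v assume "v \<in> integer_differences P a"
  then have "eq_row P i \<bullet> a = eq_rhs P i" "eq_row P i \<bullet> (a + real_vec v) = eq_rhs P i"
    if "i < num_eq P" for i
    using assms that
    by (auto simp: integer_differences_def ILD_feasible_def LD_feasible_def solutions_def)
  then show "v \<in> row_perp P"
    by (simp add: row_perp_def inner_add_right flip: real_vec_def)
qed

lemma aff_dim_integer_hull:
  assumes "a \<in> ILD_feasible P"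
  shows "aff_dim (integer_hull P) = int (vec.dim (integer_differences P a))"
proof -
  have "aff_dim (integer_hull P) = aff_dim (ILD_feasible P)"
    by (simp add: integer_hull_def aff_dim_convex_hull)
  also have "\<dots> = int (dim ((+) (- a) ` ILD_feasible P))"
    using assms by (intro aff_dim_eq_dim hull_inc)
  also have "\<dots> = int (vec.dim (integer_differences P a))"
    by (simp only: dim_image_real_vec flip: real_vec_integer_differences[OF assms])
  finally show ?thesis .
qed


section \<open>The dimension of the integer hull\<close>

theorem theorem10:
  fixes P :: "'n::finite ild"
    and l :: nat
    and m :: "nat \<Rightarrow> nat"
    and W :: "nat \<Rightarrow> (rat ^ 'n) set"
  assumes "bounded (integer_hull P) \<or> rational_data P"
    and "standard_form P"
    and "ILD_feasible P \<noteq> {}"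
    and "orthogonal_irreducible_decomposition (LD_group P) (row_perp P) l m W"
  shows "aff_dim (integer_hull P) \<in>
    {(\<Sum>j<l. m' j * int (vec.dim (W j))) | m' :: nat \<Rightarrow> int. \<forall>j<l. 0 \<le> m' j \<and> m' j \<le> int (m j)}"
proof -
  obtain a where a: "a \<in> ILD_feasible P" using assms(3) by blast
  define L where "L = vec.span (integer_differences P a)"
  have "subrep (LD_group P) L"
    unfolding L_def using permute_integer_differences_in_span[OF a] by (rule subrep_span)
  moreover have "L \<subseteq> row_perp P"
    unfolding L_def using integer_differences_subset_row_perp[OF a] subspace_row_perp
    by (rule vec.span_minimal)
  ultimately obtain n :: "nat \<Rightarrow> nat" where n: "\<And>j. j < l \<Longrightarrow> n j \<le> m j"
      "vec.dim L = (\<Sum>j<l. n j * vec.dim (W j))"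
    using dim_subrep_of_orthogonal_irreducible_decomposition[OF assms(4)] by blast
  have "aff_dim (integer_hull P) = int (vec.dim L)"
    by (simp add: aff_dim_integer_hull[OF a] L_def)
  also have "\<dots> = (\<Sum>j<l. int (n j) * int (vec.dim (W j)))"
    by (simp add: n(2))
  finally show ?thesis
    using n(1) by (intro CollectI exI[of _ "\<lambda>j. int (n j)"]) simp
qed

end
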